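(* Let $A$ be a $p$-semisimple pseudo-BCI algebra and let $\mathcal{IDOP}(A)$ be the set of all maps $A\to A$ that are both type I and type II implicative derivations. Then $(\mathcal{IDOP}(A),\circ,\mathrm{Id}_A)$ is a commutative monoid, where $\circ$ is composition of maps.
   Context: A pseudo-BCI algebra is a structure $(A,\to,\rightsquigarrow,1)$ of type $(2,2,0)$ such that for all $x,y,z\in A$: $(x\to y)\rightsquigarrow[(y\to z)\rightsquigarrow(x\to z)]=1$; $(x\rightsquigarrow y)\to[(y\rightsquigarrow z)\to(x\rightsquigarrow z)]=1$; $1\to x=x$; $1\rightsquigarrow x=x$; and $x\to y=1$, $y\to x=1$ imply $x=y$. Write $x\le y$ iff $x\to y=1$. $A$ is $p$-semisimple if $x\le 1$ implies $x=1$. Put $x\Cup_1 y=(x\to y)\rightsquigarrow y$ and $x\Cup_2 y=(x\rightsquigarrow y)\to y$. A map $d:A\to A$ is a type I implicative derivation if $d(x\to y)=(x\to d(y))\Cup_2(d(x)\to y)$ and $d(x\rightsquigarrow y)=(x\rightsquigarrow d(y))\Cup_1(d(x)\rightsquigarrow y)$ for all $x,y$; it is a type II implicative derivation if $d(x\to y)=(d(x)\to y)\Cup_2(x\to d(y))$ and $d(x\rightsquigarrow y)=(d(x)\rightsquigarrow y)\Cup_1(x\rightsquigarrow d(y))$ for all $x,y$. *)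

theory Defs
  imports "HOL-Algebra.Group"
begin

text \<open>The two implications of a pseudo-BCI algebra are written \<open>\<rightharpoonup>\<close> (usually an
  ordinary right arrow, which is taken by function spaces) and \<open>\<leadsto>\<close>.\<close>

record 'a pseudo_bci = "'a partial_object" +
  imp :: "['a, 'a] \<Rightarrow> 'a" (infixr "\<rightharpoonup>\<index>" 65)
  sq_imp :: "['a, 'a] \<Rightarrow> 'a" (infixr "\<leadsto>\<index>" 65)
  bci_one :: 'a ("\<^bold>1\<index>")

locale pseudo_bci_algebra =
  fixes A (structure)
  assumes imp_closed: "\<lbrakk>x \<in> carrier A; y \<in> carrier A\<rbrakk> \<Longrightarrow> x \<rightharpoonup> y \<in> carrier A"
    and sq_imp_closed: "\<lbrakk>x \<in> carrier A; y \<in> carrier A\<rbrakk> \<Longrightarrow> x \<leadsto> y \<in> carrier A"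
    and unit_closed: "\<^bold>1 \<in> carrier A"
    and imp_trans: "\<lbrakk>x \<in> carrier A; y \<in> carrier A; z \<in> carrier A\<rbrakk>
      \<Longrightarrow> (x \<rightharpoonup> y) \<leadsto> ((y \<rightharpoonup> z) \<leadsto> (x \<rightharpoonup> z)) = \<^bold>1"
    and sq_imp_trans: "\<lbrakk>x \<in> carrier A; y \<in> carrier A; z \<in> carrier A\<rbrakk>
      \<Longrightarrow> (x \<leadsto> y) \<rightharpoonup> ((y \<leadsto> z) \<rightharpoonup> (x \<leadsto> z)) = \<^bold>1"
    and unit_imp: "x \<in> carrier A \<Longrightarrow> \<^bold>1 \<rightharpoonup> x = x"
    and unit_sq_imp: "x \<in> carrier A \<Longrightarrow> \<^bold>1 \<leadsto> x = x"
    and imp_antisym: "\<lbrakk>x \<in> carrier A; y \<in> carrier A; x \<rightharpoonup> y = \<^bold>1; y \<rightharpoonup> x = \<^bold>1\<rbrakk> \<Longrightarrow> x = y"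

definition bci_le :: "[('a, 'b) pseudo_bci_scheme, 'a, 'a] \<Rightarrow> bool" where
  "bci_le A x y \<longleftrightarrow> x \<rightharpoonup>\<^bsub>A\<^esub> y = \<^bold>1\<^bsub>A\<^esub>"

locale p_semisimple_pseudo_bci_algebra = pseudo_bci_algebra +
  assumes p_semisimple: "\<lbrakk>x \<in> carrier A; bci_le A x \<^bold>1\<rbrakk> \<Longrightarrow> x = \<^bold>1"

definition cup1 :: "[('a, 'b) pseudo_bci_scheme, 'a, 'a] \<Rightarrow> 'a" where
  "cup1 A x y = (x \<rightharpoonup>\<^bsub>A\<^esub> y) \<leadsto>\<^bsub>A\<^esub> y"

definition cup2 :: "[('a, 'b) pseudo_bci_scheme, 'a, 'a] \<Rightarrow> 'a" where
  "cup2 A x y = (x \<leadsto>\<^bsub>A\<^esub> y) \<rightharpoonup>\<^bsub>A\<^esub> y"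

text \<open>Self-maps of the carrier are represented by extensional functions
  (\<^term>\<open>undefined\<close> outside the carrier), so that equality of functions is equality of maps.\<close>

definition type1_impl_derivation :: "[('a, 'b) pseudo_bci_scheme, 'a \<Rightarrow> 'a] \<Rightarrow> bool" where
  "type1_impl_derivation A d \<longleftrightarrow>
     d \<in> carrier A \<rightarrow>\<^sub>E carrier A \<and>
     (\<forall>x\<in>carrier A. \<forall>y\<in>carrier A.
        d (x \<rightharpoonup>\<^bsub>A\<^esub> y) = cup2 A (x \<rightharpoonup>\<^bsub>A\<^esub> d y) (d x \<rightharpoonup>\<^bsub>A\<^esub> y) \<and>
        d (x \<leadsto>\<^bsub>A\<^esub> y) = cup1 A (x \<leadsto>\<^bsub>A\<^esub> d y) (d x \<leadsto>\<^bsub>A\<^esub> y))"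

definition type2_impl_derivation :: "[('a, 'b) pseudo_bci_scheme, 'a \<Rightarrow> 'a] \<Rightarrow> bool" where
  "type2_impl_derivation A d \<longleftrightarrow>
     d \<in> carrier A \<rightarrow>\<^sub>E carrier A \<and>
     (\<forall>x\<in>carrier A. \<forall>y\<in>carrier A.
        d (x \<rightharpoonup>\<^bsub>A\<^esub> y) = cup2 A (d x \<rightharpoonup>\<^bsub>A\<^esub> y) (x \<rightharpoonup>\<^bsub>A\<^esub> d y) \<and>
        d (x \<leadsto>\<^bsub>A\<^esub> y) = cup1 A (d x \<leadsto>\<^bsub>A\<^esub> y) (x \<leadsto>\<^bsub>A\<^esub> d y))"

definition IDOP :: "('a, 'b) pseudo_bci_scheme \<Rightarrow> ('a \<Rightarrow> 'a) set" where
  "IDOP A = {d. type1_impl_derivation A d \<and> type2_impl_derivation A d}"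

definition IDOP_monoid :: "('a, 'b) pseudo_bci_scheme \<Rightarrow> ('a \<Rightarrow> 'a) monoid" where
  "IDOP_monoid A = \<lparr>carrier = IDOP A, mult = compose (carrier A), one = (\<lambda>x\<in>carrier A. x)\<rparr>"

end

theory Submission
  imports Defs
begin

text \<open>In a \<open>p\<close>-semisimple algebra the order is equality, so \<open>x \<le> x \<Cup> y\<close> makes both \<open>\<Cup>\<^sub>1\<close> and
  \<open>\<Cup>\<^sub>2\<close> the first projection. A map \<open>d\<close> is then in \<open>IDOP\<close> iff it can be moved onto either argument of
  either implication. Hence \<open>d (e (x \<rightharpoonup> y)) = d x \<rightharpoonup> e y = e (d (x \<rightharpoonup> y))\<close>, and \<open>x = \<^bold>1 \<rightharpoonup> x\<close> gives
  commutativity.\<close>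

context pseudo_bci_algebra
begin

text \<open>Transitivity for \<open>\<leadsto>\<close>, taken at the unit, the unit and
  \<open>x\<close>, collapses to this under the unit laws.\<close>

lemma imp_refl: "x \<in> carrier A \<Longrightarrow> x \<rightharpoonup> x = \<^bold>1"
  using sq_imp_trans[of "\<^bold>1" "\<^bold>1" x] by (simp add: unit_closed unit_imp unit_sq_imp imp_closed)

text \<open>Transitivity with the unit as first argument becomes this bound; \<open>imp_cup2\<close>
  is its mirror image.\<close>

lemma sq_imp_cup1:
  "\<lbrakk>x \<in> carrier A; y \<in> carrier A\<rbrakk> \<Longrightarrow> x \<leadsto> cup1 A x y = \<^bold>1"
  using imp_trans[of "\<^bold>1" x y] by (simp add: cup1_def unit_closed unit_imp)

lemma imp_cup2:
  "\<lbrakk>x \<in> carrier A; y \<in> carrier A\<rbrakk> \<Longrightarrow> x \<rightharpoonup> cup2 A x y = \<^bold>1"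
  using sq_imp_trans[of "\<^bold>1" x y] by (simp add: cup2_def unit_closed unit_sq_imp)

text \<open>Both arrows define the same order: if one of them yields the unit, the matching cup
  reduces to \<open>y\<close>, and the bound by that cup becomes the equation for the other
  arrow.\<close>

lemma sq_imp_eq_unit_iff:
  assumes "x \<in> carrier A" "y \<in> carrier A"
  shows "x \<leadsto> y = \<^bold>1 \<longleftrightarrow> x \<rightharpoonup> y = \<^bold>1"
  using sq_imp_cup1[OF assms] imp_cup2[OF assms] assms
  by (auto simp: cup1_def cup2_def unit_imp unit_sq_imp)

lemma cup1_closed: "\<lbrakk>x \<in> carrier A; y \<in> carrier A\<rbrakk> \<Longrightarrow> cup1 A x y \<in> carrier A"
  by (simp add: cup1_def imp_closed sq_imp_closed)

lemma cup2_closed: "\<lbrakk>x \<in> carrier A; y \<in> carrier A\<rbrakk> \<Longrightarrow> cup2 A x y \<in> carrier A"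
  by (simp add: cup2_def imp_closed sq_imp_closed)

end

context p_semisimple_pseudo_bci_algebra
begin

lemma imp_eq_unit_imp_eq:
  assumes x: "x \<in> carrier A" and y: "y \<in> carrier A" and le: "x \<rightharpoonup> y = \<^bold>1"
  shows "x = y"
proof -
  have yx: "y \<rightharpoonup> x \<in> carrier A"
    using x y by (rule imp_closed[rotated])
  \<comment> \<open>Transitivity around the loop \<open>x\<close>, \<open>y\<close>,
    \<open>x\<close> puts \<open>y \<rightharpoonup> x\<close> below the unit, where
    p-semisimplicity applies.\<close>
  have "(y \<rightharpoonup> x) \<leadsto> \<^bold>1 = \<^bold>1"
    using imp_trans[OF x y x] x yx by (simp add: le imp_refl unit_sq_imp sq_imp_closed unit_closed)
  then have "y \<rightharpoonup> x = \<^bold>1"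
    using yx by (simp add: p_semisimple bci_le_def sq_imp_eq_unit_iff unit_closed)
  with x y le show ?thesis
    by (rule imp_antisym)
qed

lemma cup1_eq: "\<lbrakk>x \<in> carrier A; y \<in> carrier A\<rbrakk> \<Longrightarrow> cup1 A x y = x"
  by (metis cup1_closed imp_eq_unit_imp_eq sq_imp_cup1 sq_imp_eq_unit_iff)

lemma cup2_eq: "\<lbrakk>x \<in> carrier A; y \<in> carrier A\<rbrakk> \<Longrightarrow> cup2 A x y = x"
  by (metis cup2_closed imp_eq_unit_imp_eq imp_cup2)

text \<open>Types I and II differ only in the order of the cup arguments. Once each cup equals its
  first argument, type I lets \<open>d\<close> pass to the right argument of an arrow and type II to
  the left one.\<close>

lemma IDOP_iff:
  "d \<in> IDOP A \<longleftrightarrow> d \<in> carrier A \<rightarrow>\<^sub>E carrier A \<and>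
     (\<forall>x\<in>carrier A. \<forall>y\<in>carrier A.
        d (x \<rightharpoonup> y) = x \<rightharpoonup> d y \<and> d (x \<rightharpoonup> y) = d x \<rightharpoonup> y \<and>
        d (x \<leadsto> y) = x \<leadsto> d y \<and> d (x \<leadsto> y) = d x \<leadsto> y)"
proof (cases "d \<in> carrier A \<rightarrow>\<^sub>E carrier A")
  case True
  then have "\<And>x. x \<in> carrier A \<Longrightarrow> d x \<in> carrier A"
    by auto
  then have "cup2 A (x \<rightharpoonup> d y) (d x \<rightharpoonup> y) = x \<rightharpoonup> d y"
    "cup2 A (d x \<rightharpoonup> y) (x \<rightharpoonup> d y) = d x \<rightharpoonup> y"
    "cup1 A (x \<leadsto> d y) (d x \<leadsto> y) = x \<leadsto> d y"
    "cup1 A (d x \<leadsto> y) (x \<leadsto> d y) = d x \<leadsto> y"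
    if "x \<in> carrier A" "y \<in> carrier A" for x y
    using that by (simp_all add: cup1_eq cup2_eq imp_closed sq_imp_closed)
  with True show ?thesis
    unfolding IDOP_def type1_impl_derivation_def type2_impl_derivation_def mem_Collect_eq
    by (simp cong: ball_cong) blast
\<comment> \<open>If \<open>d\<close> is not an extensional self-map of the carrier, both sides are
  false.\<close>
qed (simp add: IDOP_def type1_impl_derivation_def)

lemma IDOP_closed: "\<lbrakk>d \<in> IDOP A; x \<in> carrier A\<rbrakk> \<Longrightarrow> d x \<in> carrier A"
  unfolding IDOP_iff by blast

lemma
  assumes "d \<in> IDOP A" "x \<in> carrier A" "y \<in> carrier A"
  shows IDOP_imp_right: "d (x \<rightharpoonup> y) = x \<rightharpoonup> d y"
    and IDOP_imp_left: "d (x \<rightharpoonup> y) = d x \<rightharpoonup> y"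
    and IDOP_sq_imp_right: "d (x \<leadsto> y) = x \<leadsto> d y"
    and IDOP_sq_imp_left: "d (x \<leadsto> y) = d x \<leadsto> y"
  using assms unfolding IDOP_iff by blast+

lemma IDOP_id: "(\<lambda>x\<in>carrier A. x) \<in> IDOP A"
  by (simp add: IDOP_iff imp_closed sq_imp_closed)

text \<open>The criterion survives composition because \<open>e\<close> and then \<open>d\<close>
  pass into the same argument; no cup of the composite has to be computed.\<close>

lemma IDOP_compose:
  assumes d: "d \<in> IDOP A" and e: "e \<in> IDOP A"
  shows "compose (carrier A) d e \<in> IDOP A"
  unfolding IDOP_iff
proof (intro conjI ballI)
  show "compose (carrier A) d e \<in> carrier A \<rightarrow>\<^sub>E carrier A"
    by (simp add: compose_def IDOP_closed[OF d] IDOP_closed[OF e])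
next
  fix x y
  assume [simp]: "x \<in> carrier A" "y \<in> carrier A"
  note [simp] = compose_eq IDOP_closed[OF d] IDOP_closed[OF e] imp_closed sq_imp_closed
  show "compose (carrier A) d e (x \<rightharpoonup> y) = x \<rightharpoonup> compose (carrier A) d e y"
    by (simp add: IDOP_imp_right[OF d] IDOP_imp_right[OF e])
  show "compose (carrier A) d e (x \<rightharpoonup> y) = compose (carrier A) d e x \<rightharpoonup> y"
    by (simp add: IDOP_imp_left[OF d] IDOP_imp_left[OF e])
  show "compose (carrier A) d e (x \<leadsto> y) = x \<leadsto> compose (carrier A) d e y"
    by (simp add: IDOP_sq_imp_right[OF d] IDOP_sq_imp_right[OF e])
  show "compose (carrier A) d e (x \<leadsto> y) = compose (carrier A) d e x \<leadsto> y"
    by (simp add: IDOP_sq_imp_left[OF d] IDOP_sq_imp_left[OF e])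
qed

lemma IDOP_commute:
  assumes d: "d \<in> IDOP A" and e: "e \<in> IDOP A" and x: "x \<in> carrier A"
  shows "d (e x) = e (d x)"
proof -
  have "d (e (\<^bold>1 \<rightharpoonup> x)) = d (\<^bold>1 \<rightharpoonup> e x)"
    by (simp only: IDOP_imp_right[OF e unit_closed x])
  also have "\<dots> = d \<^bold>1 \<rightharpoonup> e x"
    by (rule IDOP_imp_left[OF d unit_closed IDOP_closed[OF e x]])
  \<comment> \<open>The two maps now sit in different arguments, so \<open>e\<close> can be pulled
    out before \<open>d\<close>, which leaves it outermost.\<close>
  also have "\<dots> = e (d \<^bold>1 \<rightharpoonup> x)"
    by (rule IDOP_imp_right[OF e IDOP_closed[OF d unit_closed] x, symmetric])
  also have "\<dots> = e (d (\<^bold>1 \<rightharpoonup> x))"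
    by (simp only: IDOP_imp_left[OF d unit_closed x])
  finally show ?thesis
    by (simp only: unit_imp[OF x])
qed

text \<open>Pointwise agreement on the carrier suffices, since both composites are
  \<open>undefined\<close> elsewhere.\<close>

lemma IDOP_compose_commute:
  assumes "d \<in> IDOP A" "e \<in> IDOP A"
  shows "compose (carrier A) d e = compose (carrier A) e d"
  using IDOP_commute[OF assms] by (auto simp: compose_def restrict_def)

end

theorem theorem4p10:
  fixes A :: "('a, 'b) pseudo_bci_scheme"
  assumes "p_semisimple_pseudo_bci_algebra A"
  shows "comm_monoid (IDOP_monoid A)"
proof -
  interpret p_semisimple_pseudo_bci_algebra A
    by fact
  \<comment> \<open>Extensionality serves the unit law: composing with the restricted identity
    returns \<open>d\<close> only if \<open>d\<close> is \<open>undefined\<close> off the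
    carrier.\<close>
  have maps: "d \<in> carrier A \<rightarrow> carrier A" "d \<in> extensional (carrier A)" if "d \<in> IDOP A" for d
    using that unfolding IDOP_iff PiE_def by blast+
  show ?thesis
  \<comment> \<open>Given commutativity, only the left unit law remains to be checked.\<close>
  proof (rule comm_monoidI)
    fix d e f
    assume "d \<in> carrier (IDOP_monoid A)" "e \<in> carrier (IDOP_monoid A)"
      "f \<in> carrier (IDOP_monoid A)"
    then show "d \<otimes>\<^bsub>IDOP_monoid A\<^esub> e \<otimes>\<^bsub>IDOP_monoid A\<^esub> f =
        d \<otimes>\<^bsub>IDOP_monoid A\<^esub> (e \<otimes>\<^bsub>IDOP_monoid A\<^esub> f)"
      by (simp add: IDOP_monoid_def compose_assoc[OF maps(1)])
  qed (simp_all add: IDOP_monoid_def IDOP_compose IDOP_id IDOP_compose_commute Id_compose maps)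
qed

end
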